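(* Let $\Gamma$ be a finite simple undirected graph with more than one vertex. If $\Gamma$ is self-complementary and distance-regular, then $\Gamma$ is a self-complementary strongly regular graph.
   Context: All graphs are finite, undirected and simple (no loops or multiple edges). The complement $\Gamma^{c}$ of a graph $\Gamma$ has the same vertex set as $\Gamma$, and two distinct vertices are adjacent in $\Gamma^{c}$ if and only if they are not adjacent in $\Gamma$. A graph is self-complementary if it is isomorphic to its complement. A connected graph $\Gamma$ of diameter $d$ is called distance-regular with intersection array $\{b_{0},b_{1},\ldots,b_{d-1};c_{1},c_{2},\ldots,c_{d}\}$ if for each $0\le i\le d$ and each pair of vertices $x,y$ at distance $i$, the number of neighbors of $x$ at distance $i+1$ from $y$ is a constant $b_i$ and the number of neighbors of $x$ at distance $i-1$ from $y$ is a constant $c_i$ (depending only on $i$, not on the pair; with $b_d=0$ and $c_0=0$). In particular such a graph is regular of valency $b_0$. A strongly regular graph is a distance-regular graph of diameter $d=2$. Such a graph has parameters $(n,k,\lambda,\mu)$: it has $n$ vertices, is $k$-regular, any two adjacent vertices have exactly $\lambda$ common neighbors, and any two distinct non-adjacent vertices have exactly $\mu$ common neighbors. *)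

theory Defs
  imports "Graph_Theory.Graph_Theory"
begin

text \<open>A finite simple undirected graph is a \<^locale>\<open>pair_graph\<close>: finite, loop-free, with a
  symmetric set of arcs, an edge between \<open>u\<close> and \<open>v\<close> being the two arcs \<open>(u, v)\<close> and \<open>(v, u)\<close>.\<close>

definition graph_complement :: "'a pair_pre_digraph \<Rightarrow> 'a pair_pre_digraph" where
  "graph_complement G =
     \<lparr> pverts = pverts G,
       parcs = {(u, v). u \<in> pverts G \<and> v \<in> pverts G \<and> u \<noteq> v \<and> (u, v) \<notin> parcs G} \<rparr>"

definition self_complementary :: "'a pair_pre_digraph \<Rightarrow> bool" where
  "self_complementary G \<longleftrightarrow> digraph_iso (with_proj G) (with_proj (graph_complement G))"

text \<open>Shortest-path distance with every arc of weight 1; it is \<open>\<infinity>\<close> if there is no walk.\<close>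

definition graph_dist :: "'a pair_pre_digraph \<Rightarrow> 'a \<Rightarrow> 'a \<Rightarrow> ereal" where
  "graph_dist G u v = wf_digraph.\<mu> (with_proj G) (\<lambda>_. 1) u v"

definition graph_diameter :: "'a pair_pre_digraph \<Rightarrow> ereal" where
  "graph_diameter G = (SUP u \<in> pverts G. SUP v \<in> pverts G. graph_dist G u v)"

text \<open>The intersection array \<open>{b 0, ..., b (d - 1); c 1, ..., c d}\<close> is given by functions \<open>b\<close> and
  \<open>c\<close>, of which only the values on \<open>{0..d}\<close> matter. For \<open>i = 0\<close> the distance \<open>i - 1\<close> is
  the real number \<open>-1\<close>, which is never attained, in accordance with \<open>c 0 = 0\<close>.\<close>

definition has_intersection_array ::
    "'a pair_pre_digraph \<Rightarrow> nat \<Rightarrow> (nat \<Rightarrow> nat) \<Rightarrow> (nat \<Rightarrow> nat) \<Rightarrow> bool" where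
  "has_intersection_array G d b c \<longleftrightarrow>
     Digraph_Component.connected (with_proj G) \<and>
     graph_diameter G = ereal (real d) \<and>
     b d = 0 \<and> c 0 = 0 \<and>
     (\<forall>i\<le>d. \<forall>x\<in>pverts G. \<forall>y\<in>pverts G. graph_dist G x y = ereal (real i) \<longrightarrow>
        card {z \<in> pverts G. (x, z) \<in> parcs G \<and> graph_dist G z y = ereal (real i + 1)} = b i \<and>
        card {z \<in> pverts G. (x, z) \<in> parcs G \<and> graph_dist G z y = ereal (real i - 1)} = c i)"

definition distance_regular :: "'a pair_pre_digraph \<Rightarrow> bool" where
  "distance_regular G \<longleftrightarrow> (\<exists>d b c. has_intersection_array G d b c)"

definition strongly_regular :: "'a pair_pre_digraph \<Rightarrow> bool" where
  "strongly_regular G \<longleftrightarrow> distance_regular G \<and> graph_diameter G = 2"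

end

theory Submission
  imports Defs
begin

text \<open>The diameter is forced by counting arcs in a regular graph. A graph on \<open>n\<close> vertices and
  its complement share out all \<open>n (n - 1)\<close> arcs of the complete graph, so a self-complementary
  graph has exactly half of them (\<open>self_complementary_twice_card_arcs\<close>); if it is also
  \<open>k\<close>-regular, then \<open>n = 2 k + 1\<close>. Two distinct non-adjacent vertices \<open>x\<close> and \<open>y\<close> then have a
  common neighbour: their neighbourhoods, of \<open>k\<close> elements each, both lie in the
  \<open>2 k - 1\<close> vertices other than \<open>x\<close> and \<open>y\<close>, so they cannot be disjoint. Hence all distances are
  at most 2. The value 2 is attained, because \<open>n > 1\<close> gives \<open>k > 0\<close>, so that every vertex has
  \<open>n - 1 - k = k > 0\<close> non-neighbours.\<close>

lemma (in pair_wf_digraph) graph_dist_eq_INF_length: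
  "graph_dist G u v = (INF p\<in>{p. awalk u p v}. ereal (length p))"
proof -
  have "awalk_cost (\<lambda>_. 1) p = length p" for p
    by (induction p) auto
  then show ?thesis
    by (simp add: graph_dist_def \<mu>_def)
qed

lemma (in pair_wf_digraph) graph_dist_le_length:
  "awalk u p v \<Longrightarrow> graph_dist G u v \<le> ereal (length p)"
  unfolding graph_dist_eq_INF_length by (rule INF_lower) simp

lemma (in pair_wf_digraph) graph_dist_geI:
  assumes "\<And>p. awalk u p v \<Longrightarrow> m \<le> ereal (length p)"
  shows "m \<le> graph_dist G u v"
  unfolding graph_dist_eq_INF_length using assms by (intro INF_greatest) simp

lemma (in pair_wf_digraph) graph_dist_ge_1:
  assumes "u \<noteq> v"
  shows "1 \<le> graph_dist G u v"
proof (rule graph_dist_geI)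
  fix p assume "awalk u p v"
  with assms have "p \<noteq> []"
    by (auto simp: awalk_Nil_iff)
  then show "1 \<le> ereal (length p)"
    by (cases p) auto
qed

lemma (in pair_wf_digraph) graph_dist_ge_2:
  assumes "u \<noteq> v" and "(u, v) \<notin> parcs G"
  shows "2 \<le> graph_dist G u v"
proof (rule graph_dist_geI)
  fix p assume p: "awalk u p v"
  from assms p obtain e p' where "p = e # p'"
    by (cases p) (auto simp: awalk_Nil_iff)
  moreover from this assms p obtain e' p'' where "p' = e' # p''"
    by (cases p') (auto simp: awalk_Cons_iff awalk_Nil_iff)
  ultimately show "2 \<le> ereal (length p)"
    by simp
qed

lemma (in pair_wf_digraph) graph_dist_self:
  assumes "v \<in> pverts G"
  shows "graph_dist G v v = 0"
proof (rule antisym)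
  show "graph_dist G v v \<le> 0"
    using graph_dist_le_length[of v "[]" v] assms by (simp add: awalk_Nil_iff zero_ereal_def)
  show "0 \<le> graph_dist G v v"
    by (rule graph_dist_geI) simp
qed

lemma (in pair_loopfree_digraph) graph_dist_arc:
  assumes "(u, v) \<in> parcs G"
  shows "graph_dist G u v = 1"
proof (rule antisym)
  show "graph_dist G u v \<le> 1"
    using graph_dist_le_length[of u "[(u, v)]" v] assms in_arcsD2[OF assms]
    by (simp add: awalk_Cons_iff awalk_Nil_iff one_ereal_def)
  show "1 \<le> graph_dist G u v"
    using graph_dist_ge_1 no_loops'[OF assms] by blast
qed

lemma (in pair_wf_digraph) graph_dist_two_arcs_le:
  assumes "(u, w) \<in> parcs G" and "(w, v) \<in> parcs G"
  shows "graph_dist G u v \<le> 2"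
  using graph_dist_le_length[of u "[(u, w), (w, v)]" v] assms in_arcsD2[OF assms(2)]
  by (simp add: awalk_Cons_iff awalk_Nil_iff)

text \<open>The case \<open>i = 0\<close>, \<open>x = y\<close> of the intersection array says that \<open>x\<close> has \<open>b 0\<close> neighbours
  at distance 1 from \<open>x\<close>, and every neighbour is at that distance.\<close>

lemma (in pair_graph) intersection_array_imp_regular:
  assumes "has_intersection_array G d b c" and "x \<in> pverts G"
  shows "card (parcs G `` {x}) = b 0"
proof -
  have "graph_dist G x x = ereal (real 0)"
    using graph_dist_self[OF assms(2)] by (simp add: zero_ereal_def)
  then have "card {z \<in> pverts G. (x, z) \<in> parcs G \<and> graph_dist G z x = ereal (real 0 + 1)} = b 0"
    using assms unfolding has_intersection_array_def by blast
  moreover have "{z \<in> pverts G. (x, z) \<in> parcs G \<and> graph_dist G z x = ereal (real 0 + 1)}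
      = parcs G `` {x}"
    using graph_dist_arc arcs_symmetric in_arcsD2 by (auto simp: one_ereal_def)
  ultimately show ?thesis
    by simp
qed

text \<open>An isomorphism is injective on arcs, so both graphs have equally many, and together they have
  as many as there are pairs off the diagonal.\<close>

lemma (in pair_digraph) self_complementary_twice_card_arcs:
  assumes "self_complementary G"
  shows "2 * card (parcs G) + card (pverts G) = card (pverts G) * card (pverts G)"
proof -
  let ?V = "pverts G" and ?C = "parcs (graph_complement G)"
  obtain h where h: "digraph_isomorphism h"
    and C: "with_proj (graph_complement G) = app_iso h (with_proj G)"
    using assms by (auto simp: self_complementary_def digraph_iso_def)
  have "?C = iso_arcs h ` parcs G"
    using arg_cong[OF C, of arcs] by simp
  then have same: "card ?C = card (parcs G)"
    using digraph_isomorphism_inj_on_arcs[OF h] by (simp add: card_image)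
  have split: "?V \<times> ?V = (parcs G \<union> ?C) \<union> Id_on ?V"
    by (auto simp: graph_complement_def dest: in_arcsD1 in_arcsD2)
  have fin: "finite ?C"
    by (rule finite_subset[of _ "?V \<times> ?V"]) (auto simp: graph_complement_def)
  have "card (Id_on ?V) = card ?V"
  proof -
    have "Id_on ?V = (\<lambda>v. (v, v)) ` ?V"
      by auto
    then show ?thesis
      by (simp add: card_image inj_on_def)
  qed
  moreover have "card ((parcs G \<union> ?C) \<union> Id_on ?V) = card (parcs G \<union> ?C) + card (Id_on ?V)"
    using fin by (intro card_Un_disjoint)
      (auto simp: graph_complement_def Id_on_def dest: no_loops')
  moreover have "card (parcs G \<union> ?C) = card (parcs G) + card ?C"
    using fin by (intro card_Un_disjoint) (auto simp: graph_complement_def)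
  ultimately show ?thesis
    using same split by (metis card_cartesian_product mult_2)
qed

lemma (in pair_digraph) self_complementary_regular_card_verts:
  assumes "self_complementary G" and "pverts G \<noteq> {}"
    and "\<And>x. x \<in> pverts G \<Longrightarrow> card (parcs G `` {x}) = k"
  shows "card (pverts G) = 2 * k + 1"
proof -
  let ?n = "card (pverts G)"
  have "parcs G = (SIGMA x : pverts G. parcs G `` {x})"
    by (auto dest: in_arcsD1)
  then have "card (parcs G) = (\<Sum>x\<in>pverts G. card (parcs G `` {x}))"
    by (metis card_SigmaI finite_verts finite_Image finite_arcs)
  also have "\<dots> = ?n * k"
    using assms(3) by simp
  finally have "?n * (2 * k + 1) = ?n * ?n"
    using self_complementary_twice_card_arcs[OF assms(1)] by (simp add: algebra_simps)
  moreover have "?n > 0"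
    using assms(2) by (simp add: card_gt_0_iff)
  ultimately show ?thesis
    by (metis mult_left_cancel less_not_refl)
qed

lemma (in pair_graph) common_neighbour_if_half_regular:
  assumes "card (pverts G) = 2 * k + 1"
    and deg: "\<And>x. x \<in> pverts G \<Longrightarrow> card (parcs G `` {x}) = k"
    and xy: "x \<in> pverts G" "y \<in> pverts G" "x \<noteq> y" "(x, y) \<notin> parcs G"
  obtains z where "(x, z) \<in> parcs G" and "(z, y) \<in> parcs G"
proof -
  let ?N = "\<lambda>v. parcs G `` {v}"
  have "?N x \<inter> ?N y \<noteq> {}"
  proof
    assume disj: "?N x \<inter> ?N y = {}"
    have "?N x \<union> ?N y \<subseteq> pverts G - {x, y}"
      using xy arcs_symmetric no_loops' in_arcsD2 by blast
    then have "card (?N x \<union> ?N y) \<le> card (pverts G - {x, y})"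
      by (intro card_mono) auto
    moreover have "card (?N x \<union> ?N y) = 2 * k"
      using disj deg xy by (subst card_Un_disjoint) auto
    moreover have "card (pverts G - {x, y}) = 2 * k + 1 - 2"
      using assms(1) xy by (subst card_Diff_subset) auto
    moreover have "2 \<le> 2 * k + 1"
      using card_mono[of "pverts G" "{x, y}"] assms(1) xy by auto
    ultimately show False
      by linarith
  qed
  then show ?thesis
    using that arcs_symmetric by blast
qed

lemma (in pair_graph) graph_diameter_eq_2_if_half_regular:
  assumes n: "card (pverts G) = 2 * k + 1" and "k > 0"
    and deg: "\<And>x. x \<in> pverts G \<Longrightarrow> card (parcs G `` {x}) = k"
  shows "graph_diameter G = 2"
proof (rule antisym)
  have "graph_dist G x y \<le> 2" if xy: "x \<in> pverts G" "y \<in> pverts G" for x y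
  proof -
    consider "x = y" | "(x, y) \<in> parcs G" | "x \<noteq> y" "(x, y) \<notin> parcs G"
      by blast
    then show ?thesis
    proof cases
      case 3
      obtain z where "(x, z) \<in> parcs G" "(z, y) \<in> parcs G"
        using common_neighbour_if_half_regular[OF n deg xy 3] by blast
      then show ?thesis
        by (rule graph_dist_two_arcs_le)
    qed (use xy in \<open>simp_all add: graph_dist_self graph_dist_arc\<close>)
  qed
  then show "graph_diameter G \<le> 2"
    unfolding graph_diameter_def by (intro SUP_least)
next
  from n have "pverts G \<noteq> {}"
    by auto
  then obtain x where x: "x \<in> pverts G"
    by blast
  have "\<not> pverts G - {x} \<subseteq> parcs G `` {x}"
  proof
    assume "pverts G - {x} \<subseteq> parcs G `` {x}"
    then have "card (pverts G - {x}) \<le> k"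
      using card_mono[of "parcs G `` {x}" "pverts G - {x}"] deg[OF x] by (simp add: finite_Image)
    with n x \<open>k > 0\<close> show False
      by simp
  qed
  then obtain y where y: "y \<in> pverts G" "x \<noteq> y" "(x, y) \<notin> parcs G"
    by blast
  then have "2 \<le> graph_dist G x y"
    by (intro graph_dist_ge_2)
  then show "2 \<le> graph_diameter G"
    unfolding graph_diameter_def using x y(1) by (meson SUP_upper2)
qed

theorem corollary2p2:
  fixes G :: "'a pair_pre_digraph"
  assumes "pair_graph G"
    and "card (pverts G) > 1"
    and "self_complementary G"
    and "distance_regular G"
  shows "self_complementary G \<and> strongly_regular G"
proof -
  interpret pair_graph G by fact
  obtain d b c where "has_intersection_array G d b c"
    using assms(4) unfolding distance_regular_def by blast
  then have deg: "card (parcs G `` {x}) = b 0" if "x \<in> pverts G" for x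
    using that by (rule intersection_array_imp_regular)
  have n: "card (pverts G) = 2 * b 0 + 1"
    using assms(2) by (intro self_complementary_regular_card_verts[OF assms(3)] deg) auto
  with assms(2) have "b 0 > 0"
    by simp
  from graph_diameter_eq_2_if_half_regular[OF n this deg] show ?thesis
    using assms(3,4) by (simp add: strongly_regular_def)
qed

end
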